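(* Let $A\in\mathbb{R}^{m\times n}$ with $m\ge n$ have full rank and nonzero rows, let $b\in\mathbb{R}^m$, let $q\ge 1$ be an integer, and let $\alpha>0$. Suppose $p_i=\frac{\|A_i\|^2}{\|A\|_F^2}$ and $w_i=\alpha$ for all $i=1,\dots,m$ (that is, $W=\mathrm{Diag}(w_1,\dots,w_m)=\alpha I$). Then the error $e^k=x^k-x^\star$ of the iterates of randomized Kaczmarz with averaging (defined in the context) satisfies at each iteration $k$ $$\mathbb{E}\left[\|e^{k+1}\|^2\right]\le \sigma_{\max}\left(\left(I-\alpha\frac{A^\top A}{\|A\|_F^2}\right)^2+\frac{\alpha^2}{q}\left(I-\frac{A^\top A}{\|A\|_F^2}\right)\frac{A^\top A}{\|A\|_F^2}\right)\|e^k\|^2+\frac{\alpha^2\|r^\star\|^2}{q\|A\|_F^2},$$ where $r^\star=b-Ax^\star$ is the least-squares residual and the expectation is conditional on $e^k$.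
   Context: $A_i$ denotes the $i$-th row of $A$ (a row vector), $\|\cdot\|$ the Euclidean norm, $\|A\|_F^2=\sum_{i,j}A_{ij}^2$, $I$ an identity matrix of the appropriate size, and $\sigma_{\max}(\cdot)$ the largest singular value. $x^\star=\arg\min_{x\in\mathbb{R}^n}\frac12\|b-Ax\|^2=A^\dagger b$ is the least-squares solution (the system $Ax=b$ need not be consistent). Randomized Kaczmarz with averaging: let $\mathcal{D}$ be the probability distribution on $\{1,\dots,m\}$ with $\mathbb{P}(i=j)=p_j$ for $i\sim\mathcal{D}$, and let $w_1,\dots,w_m\in\mathbb{R}$ be weights. Starting from $x^0\in\mathbb{R}^n$, at each iteration $k=0,1,2,\dots$ one draws a collection (multiset) $\tau_k$ of $q$ indices sampled independently, with replacement, from $\mathcal{D}$ (independently of the previous iterations), and sets $$x^{k+1}=x^k-\frac1q\sum_{i\in\tau_k}w_i\frac{A_ix^k-b_i}{\|A_i\|^2}A_i^\top,$$ where the sum is over the $q$ sampled indices counted with multiplicity. The conditional expectation given $e^k$ is over the random draw of $\tau_k$ only. *)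

theory Defs
  imports "HOL-Probability.Probability"
begin

text \<open>Matrices in \<open>real ^ 'n ^ 'm\<close> have \<open>m = CARD('m)\<close> rows and \<open>n = CARD('n)\<close> columns; the library
  norm on \<open>real ^ 'n\<close> is the Euclidean norm.\<close>

definition frobenius_norm :: "real ^ 'n ^ 'm \<Rightarrow> real" where
  "frobenius_norm A = sqrt (\<Sum>i\<in>UNIV. \<Sum>j\<in>UNIV. (A $ i $ j)\<^sup>2)"

text \<open>The singular values are the square roots of the eigenvalues of \<open>B\<^sup>T B\<close>.\<close>

definition singular_values :: "real ^ 'n ^ 'n \<Rightarrow> real set" where
  "singular_values B =
     {sqrt \<mu> | \<mu>. \<exists>v. v \<noteq> 0 \<and> (transpose B ** B) *v v = \<mu> *\<^sub>R v}"

definition sigma_max :: "real ^ 'n ^ 'n \<Rightarrow> real" where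
  "sigma_max B = Max (singular_values B)"

definition least_squares_solution :: "real ^ 'n ^ 'm \<Rightarrow> real ^ 'm \<Rightarrow> real ^ 'n" where
  "least_squares_solution A b = (ARG_MIN (\<lambda>x. 1 / 2 * (norm (b - A *v x))\<^sup>2) x. True)"

definition kaczmarz_avg_step ::
  "real ^ 'n ^ 'm \<Rightarrow> real ^ 'm \<Rightarrow> ('m \<Rightarrow> real) \<Rightarrow> nat \<Rightarrow> 'm multiset \<Rightarrow> real ^ 'n \<Rightarrow> real ^ 'n" where
  "kaczmarz_avg_step A b w q \<tau> x =
     x - (1 / real q) *\<^sub>R
       (\<Sum>i\<in>#\<tau>. (w i * ((row i A \<bullet> x - b $ i) / (norm (row i A))\<^sup>2)) *\<^sub>R row i A)"

primrec kaczmarz_avg_iterate ::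
  "real ^ 'n ^ 'm \<Rightarrow> real ^ 'm \<Rightarrow> ('m \<Rightarrow> real) \<Rightarrow> nat \<Rightarrow> real ^ 'n \<Rightarrow> (nat \<Rightarrow> 'm multiset) \<Rightarrow> nat
    \<Rightarrow> real ^ 'n" where
  "kaczmarz_avg_iterate A b w q x0 \<tau> 0 = x0"
| "kaczmarz_avg_iterate A b w q x0 \<tau> (Suc k) =
     kaczmarz_avg_step A b w q (\<tau> k) (kaczmarz_avg_iterate A b w q x0 \<tau> k)"

end

theory Submission
  imports Defs
begin

text \<open>
  By the normal equation \<open>A\<^sup>T r\<^sup>\<star> = 0\<close>, a single Kaczmarz direction at error \<open>z\<close> has mean \<open>G z\<close> and
  second moment \<open>z \<bullet> G z + \<parallel>r\<^sup>\<star>\<parallel>\<^sup>2 / \<parallel>A\<parallel>\<^sub>F\<^sup>2\<close>. Averaging \<open>q\<close> independent directions divides the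
  variance by \<open>q\<close>, so the bias-variance decomposition expresses the expected squared error exactly as
  \<open>z \<bullet> B z + \<alpha>\<^sup>2 \<parallel>r\<^sup>\<star>\<parallel>\<^sup>2 / (q \<parallel>A\<parallel>\<^sub>F\<^sup>2)\<close>, where \<open>B\<close> is the matrix inside \<open>\<sigma>\<^sub>m\<^sub>a\<^sub>x\<close>. The inequality only
  enters through \<open>z \<bullet> B z \<le> \<sigma>\<^sub>m\<^sub>a\<^sub>x(B) \<parallel>z\<parallel>\<^sup>2\<close>. Since the current error depends on past draws only, the
  conditional expectation is obtained by freezing its value.
\<close>

section \<open>The largest singular value as a bound on quadratic forms\<close>

lemma inner_transpose_matrix_vector:
  fixes A :: "real ^ 'n ^ 'm"
  shows "(transpose A *v u) \<bullet> v = u \<bullet> (A *v v)"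
  by (simp add: transpose_matrix_vector dot_lmul_matrix)

text \<open>The quadratic form attains a maximum on the compact unit sphere, and the first-order
  condition makes a maximiser an eigenvector. Applied to \<open>transpose B ** B\<close>, this
  supplies the largest squared singular value.\<close>

lemma symmetric_top_eigenvector:
  fixes C :: "real ^ 'n ^ 'n"
  assumes sym: "transpose C = C"
  obtains \<mu> v where "v \<noteq> 0" "C *v v = \<mu> *\<^sub>R v" "\<And>u. u \<bullet> (C *v u) \<le> \<mu> * (norm u)\<^sup>2"
proof -
  have cont: "continuous_on (sphere 0 1) (\<lambda>u. u \<bullet> (C *v u))"
    by (intro continuous_intros linear_continuous_on_compose[OF continuous_on_id]) auto
  have "sphere (0 :: real ^ 'n) 1 \<noteq> {}" by simp
  then obtain v where v: "v \<in> sphere 0 1"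
    and vmax: "\<And>u. u \<in> sphere 0 1 \<Longrightarrow> u \<bullet> (C *v u) \<le> v \<bullet> (C *v v)"
    using continuous_attains_sup[OF compact_sphere _ cont] by blast
  define \<mu> where "\<mu> = v \<bullet> (C *v v)"
  \<comment> \<open>Both sides are homogeneous of degree two, so normalising \<open>u\<close>
    reduces the claim to the sphere.\<close>
  have bound: "u \<bullet> (C *v u) \<le> \<mu> * (norm u)\<^sup>2" for u
  proof (cases "u = 0")
    case False
    have "(u /\<^sub>R norm u) \<bullet> (C *v (u /\<^sub>R norm u)) \<le> \<mu>"
      unfolding \<mu>_def using False by (intro vmax) simp
    then have "(u \<bullet> (C *v u)) / (norm u)\<^sup>2 \<le> \<mu>"
      by (simp add: matrix_vector_mult_scaleR power2_eq_square divide_inverse mult_ac)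
    then show ?thesis using False by (simp add: field_simps)
  qed (simp add: matrix_vector_mult_0_right)
  define d where "d = C *v v - \<mu> *\<^sub>R v"
  have nv: "v \<bullet> v = 1" using v by (simp add: norm_eq_1)
  have vCd: "v \<bullet> (C *v d) = d \<bullet> (C *v v)"
    using inner_transpose_matrix_vector[of C v d] sym by (simp add: inner_commute)
  \<comment> \<open>Otherwise moving from \<open>v\<close> along the residual \<open>d\<close> increases the Rayleigh quotient to first order.\<close>
  have "d = 0"
  proof (rule ccontr)
    assume "d \<noteq> 0"
    then have dd: "d \<bullet> d > 0" by simp
    \<comment> \<open>In the bound at \<open>v + t *\<^sub>R d\<close> the constant terms and those
      in \<open>d \<bullet> v\<close> cancel, leaving \<open>2 * t * (d \<bullet> d)\<close> at
      first order and \<open>K\<close> as the coefficient at second order.\<close>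
    define K where "K = \<mu> * (d \<bullet> d) - d \<bullet> (C *v d)"
    have ineq: "2 * t * (d \<bullet> d) \<le> t\<^sup>2 * K" for t
    proof -
      have "(v + t *\<^sub>R d) \<bullet> (C *v (v + t *\<^sub>R d)) \<le> \<mu> * ((v + t *\<^sub>R d) \<bullet> (v + t *\<^sub>R d))"
        using bound[of "v + t *\<^sub>R d"] by (simp add: power2_norm_eq_inner)
      then have "\<mu> + 2 * t * (d \<bullet> (C *v v)) + t\<^sup>2 * (d \<bullet> (C *v d))
          \<le> \<mu> * (1 + 2 * t * (d \<bullet> v) + t\<^sup>2 * (d \<bullet> d))"
        using vCd nv
        by (simp add: matrix_vector_right_distrib matrix_vector_mult_scaleR inner_simps \<mu>_def
            inner_commute[of v d] power2_eq_square algebra_simps)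
      moreover have "d \<bullet> (C *v v) = d \<bullet> d + \<mu> * (d \<bullet> v)"
        by (simp add: d_def inner_simps)
      ultimately show ?thesis by (simp add: K_def algebra_simps)
    qed
    have "K > 0" using ineq[of 1] dd by (simp del: inner_gt_zero_iff)
    \<comment> \<open>This \<open>t\<close> maximises
      \<open>2 * t * (d \<bullet> d) - t\<^sup>2 * K\<close>; the maximum
      \<open>(d \<bullet> d)\<^sup>2 / K\<close> is positive, against \<open>ineq\<close>.\<close>
    have "2 * (d \<bullet> d / K) * (d \<bullet> d) \<le> (d \<bullet> d / K)\<^sup>2 * K" by (rule ineq)
    then have "2 * (d \<bullet> d)\<^sup>2 / K \<le> (d \<bullet> d)\<^sup>2 / K"
      using \<open>K > 0\<close> by (simp add: power2_eq_square)
    then show False using \<open>K > 0\<close> dd by (simp add: field_simps)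
  qed
  then have "C *v v = \<mu> *\<^sub>R v" by (simp add: d_def)
  moreover have "v \<noteq> 0" using nv by auto
  ultimately show ?thesis using that bound by blast
qed

text \<open>Eigenvectors of distinct eigenvalues are orthogonal, so choosing one per eigenvalue
  gives an independent set, which is finite in finite dimension. Finiteness makes the
  \<open>Max\<close> in \<open>sigma_max\<close> a genuine upper bound.\<close>

lemma finite_symmetric_eigenvalues:
  fixes C :: "real ^ 'n ^ 'n"
  assumes sym: "transpose C = C"
  shows "finite {\<mu>. \<exists>v. v \<noteq> 0 \<and> C *v v = \<mu> *\<^sub>R v}" (is "finite ?E")
proof -
  define f where "f \<mu> = (SOME v. v \<noteq> 0 \<and> C *v v = \<mu> *\<^sub>R v)" for \<mu>
  define E where "E = ?E"
  have f: "f \<mu> \<noteq> 0 \<and> C *v f \<mu> = \<mu> *\<^sub>R f \<mu>" if "\<mu> \<in> E" for \<mu>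
    unfolding f_def using that[unfolded E_def]
    by (intro someI_ex[where P = "\<lambda>v. v \<noteq> 0 \<and> C *v v = \<mu> *\<^sub>R v"]) simp
  have inj: "inj_on f E"
  proof (rule inj_onI)
    fix \<mu> \<nu> assume *: "\<mu> \<in> E" "\<nu> \<in> E" "f \<mu> = f \<nu>"
    have "\<mu> *\<^sub>R f \<mu> = C *v f \<mu>" by (rule HOL.sym[OF conjunct2[OF f[OF *(1)]]])
    also have "\<dots> = C *v f \<nu>" by (rule arg_cong[OF *(3)])
    also have "\<dots> = \<nu> *\<^sub>R f \<nu>" using f[OF *(2)] by (rule conjunct2)
    also have "\<dots> = \<nu> *\<^sub>R f \<mu>" by (simp only: *(3))
    finally show "\<mu> = \<nu>" using conjunct1[OF f[OF *(1)]] by simp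
  qed
  have orth: "f \<mu> \<bullet> f \<nu> = 0" if *: "\<mu> \<in> E" "\<nu> \<in> E" "\<mu> \<noteq> \<nu>" for \<mu> \<nu>
  proof -
    have "(C *v f \<mu>) \<bullet> f \<nu> = f \<mu> \<bullet> (C *v f \<nu>)"
      using inner_transpose_matrix_vector[of C "f \<mu>" "f \<nu>"] sym by simp
    then have "\<mu> * (f \<mu> \<bullet> f \<nu>) = \<nu> * (f \<mu> \<bullet> f \<nu>)"
      unfolding conjunct2[OF f[OF *(1)]] conjunct2[OF f[OF *(2)]] by simp
    then show ?thesis using *(3) by simp
  qed
  have "pairwise orthogonal (f ` E)"
    unfolding pairwise_def orthogonal_def
  proof (intro ballI impI)
    fix x y assume "x \<in> f ` E" "y \<in> f ` E" "x \<noteq> y"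
    then obtain \<mu> \<nu> where "x = f \<mu>" "y = f \<nu>" "\<mu> \<in> E" "\<nu> \<in> E" "\<mu> \<noteq> \<nu>" by blast
    then show "x \<bullet> y = 0" using orth by simp
  qed
  moreover have "0 \<notin> f ` E" using f by (metis imageE)
  ultimately have "finite (f ` E)"
    by (intro independent_imp_finite pairwise_orthogonal_independent)
  then show ?thesis using inj unfolding E_def by (rule finite_imageD)
qed

text \<open>The quadratic form of \<open>transpose B ** B\<close> is
  \<open>(norm (B *v u))\<^sup>2\<close>, so its top eigenvalue controls this norm, and the root of
  that eigenvalue is one of the singular values under the \<open>Max\<close>.\<close>

lemma norm_matrix_vector_le_sigma_max:
  fixes B :: "real ^ 'n ^ 'n"
  shows "norm (B *v u) \<le> sigma_max B * norm u"
proof -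
  let ?C = "transpose B ** B"
  have sym: "transpose ?C = ?C" by (simp add: matrix_transpose_mul)
  have quad: "u \<bullet> (?C *v u) = (norm (B *v u))\<^sup>2" for u
    using inner_transpose_matrix_vector[of B "B *v u" u]
    by (simp add: matrix_vector_mul_assoc[symmetric] power2_norm_eq_inner inner_commute)
  obtain \<mu> v where v: "v \<noteq> 0" "?C *v v = \<mu> *\<^sub>R v"
    and top: "\<And>u. u \<bullet> (?C *v u) \<le> \<mu> * (norm u)\<^sup>2"
    using symmetric_top_eigenvector[OF sym] by metis
  have "singular_values B = sqrt ` {\<mu>. \<exists>v. v \<noteq> 0 \<and> ?C *v v = \<mu> *\<^sub>R v}"
    by (auto simp: singular_values_def)
  then have "sqrt \<mu> \<le> sigma_max B"
    unfolding sigma_max_def using v finite_symmetric_eigenvalues[OF sym] by (intro Max_ge) auto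
  have "norm (B *v u) = sqrt (u \<bullet> (?C *v u))" by (simp add: quad)
  also have "\<dots> \<le> sqrt (\<mu> * (norm u)\<^sup>2)" using top by (rule real_sqrt_le_mono)
  also have "\<dots> = sqrt \<mu> * norm u" by (simp add: real_sqrt_mult)
  also have "\<dots> \<le> sigma_max B * norm u"
    using \<open>sqrt \<mu> \<le> sigma_max B\<close> by (intro mult_right_mono) auto
  finally show ?thesis .
qed

text \<open>Cauchy-Schwarz passes from the operator-norm bound to the quadratic form in which the
  expected squared error is expressed.\<close>

lemma quadratic_form_le_sigma_max:
  fixes B :: "real ^ 'n ^ 'n"
  shows "u \<bullet> (B *v u) \<le> sigma_max B * (norm u)\<^sup>2"
proof -
  have "u \<bullet> (B *v u) \<le> norm u * norm (B *v u)" by (rule norm_cauchy_schwarz)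
  also have "\<dots> \<le> norm u * (sigma_max B * norm u)"
    by (intro mult_left_mono norm_matrix_vector_le_sigma_max) simp
  finally show ?thesis by (simp add: power2_eq_square mult_ac)
qed

section \<open>Least squares\<close>

text \<open>Split \<open>b\<close> into its projection \<open>A *v x0\<close> on the column space
  and an orthogonal remainder \<open>z\<close>. By Pythagoras a minimiser has the same image under
  \<open>A\<close> as \<open>x0\<close>, so its residual is \<open>z\<close>.\<close>

lemma least_squares_normal_equation:
  fixes A :: "real ^ 'n ^ 'm"
  shows "transpose A *v (b - A *v least_squares_solution A b) = 0"
proof -
  let ?f = "\<lambda>x. 1 / 2 * (norm (b - A *v x))\<^sup>2"
  obtain y z where y: "y \<in> span (range ((*v) A))"
    and z: "\<And>w. w \<in> span (range ((*v) A)) \<Longrightarrow> orthogonal z w" and b: "b = y + z"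
    using orthogonal_subspace_decomp_exists by blast
  have "span (range ((*v) A)) = range ((*v) A)"
    by (intro span_eq_iff[THEN iffD2] linear_subspace_image) auto
  then obtain x0 where x0: "y = A *v x0" using y by (metis imageE)
  have ortho: "z \<bullet> (A *v u) = 0" for u
    using z[of "A *v u"] by (auto simp: orthogonal_def intro: span_base)
  have f: "?f x = 1 / 2 * (norm z)\<^sup>2 + 1 / 2 * (norm (A *v (x0 - x)))\<^sup>2" for x
  proof -
    have "b - A *v x = z + A *v (x0 - x)"
      by (simp add: b x0 matrix_vector_mult_diff_distrib)
    then show ?thesis using ortho[of "x0 - x"]
      by (simp add: norm_add_Pythagorean orthogonal_def)
  qed
  have "A *v (x0 - least_squares_solution A b) = 0"
    unfolding least_squares_solution_def
  \<comment> \<open>The point \<open>x0\<close> shows that the minimum is attained, so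
    \<open>ARG_MIN\<close> picks a true minimiser; the conclusion is checked for an arbitrary
    one.\<close>
  proof (rule arg_minI[where x = x0])
    fix x assume "\<forall>y. True \<longrightarrow> \<not> ?f y < ?f x"
    then have "?f x \<le> ?f x0" by (simp add: not_less)
    then show "A *v (x0 - x) = 0" unfolding f by simp
  qed (unfold f, simp_all)
  then have "b - A *v least_squares_solution A b = z"
    by (simp add: b x0 matrix_vector_mult_diff_distrib)
  \<comment> \<open>Moving one transpose across turns the squared norm into
    \<open>z \<bullet> (A *v u)\<close> with \<open>u = transpose A *v z\<close>.\<close>
  moreover have "(transpose A *v z) \<bullet> (transpose A *v z) = 0"
    by (simp only: inner_transpose_matrix_vector ortho)
  ultimately show ?thesis by simp
qed

section \<open>Conditional expectations and averages of independent draws\<close>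

context prob_space
begin

lemma integrable_finite_range:
  fixes h :: "'c \<Rightarrow> real"
  assumes U: "random_variable (count_space C) U" and "finite C"
  shows "integrable M (\<lambda>\<omega>. h (U \<omega>))"
proof (rule integrable_const_bound[where B = "\<Sum>u\<in>C. \<bar>h u\<bar>"])
  show "AE \<omega> in M. norm (h (U \<omega>)) \<le> (\<Sum>u\<in>C. \<bar>h u\<bar>)"
    using measurable_space[OF U] \<open>finite C\<close> by (auto intro!: AE_I2 member_le_sum)
  show "(\<lambda>\<omega>. h (U \<omega>)) \<in> borel_measurable M"
    using U by (rule measurable_compose) simp
qed

text \<open>The predicate \<open>indep_var\<close> forces both variables to have the same value type; writing the
  conditioning variable as \<open>g (U \<omega>)\<close> leaves its type free.\<close>

lemma real_cond_exp_freeze: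
  fixes f :: "'b \<Rightarrow> 'c \<Rightarrow> real"
  assumes indep: "indep_var L U (count_space C) V" and "finite C"
    and g [measurable]: "g \<in> measurable L N"
    and f [measurable]: "\<And>v. v \<in> C \<Longrightarrow> (\<lambda>x. f x v) \<in> borel_measurable N"
    and int0: "\<And>v. v \<in> C \<Longrightarrow> integrable M (\<lambda>\<omega>. f (g (U \<omega>)) v)"
  defines "X \<equiv> \<lambda>\<omega>. g (U \<omega>)"
  shows "AE \<omega> in M. real_cond_exp M (vimage_algebra (space M) X N) (\<lambda>\<omega>. f (X \<omega>) (V \<omega>)) \<omega>
           = expectation (\<lambda>\<omega>'. f (X \<omega>) (V \<omega>'))"
proof -
  let ?F = "vimage_algebra (space M) X N"
  have [measurable]: "random_variable L U" and V [measurable]: "random_variable (count_space C) V"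
    using indep by (auto dest: indep_var_rv1 indep_var_rv2)
  have X [measurable]: "random_variable N X" unfolding X_def by measurable
  have int: "integrable M (\<lambda>\<omega>. f (X \<omega>) v)" if "v \<in> C" for v
    using int0[OF that] by (simp add: X_def)
  have Vsp: "V \<omega> \<in> C" if "\<omega> \<in> space M" for \<omega>
    using measurable_space[OF V that] by simp
  have Xsp: "X \<in> space M \<rightarrow> space N" using measurable_space[OF X] by blast
  have sub: "subalgebra M ?F"
    unfolding subalgebra_def using measurable_sets[OF X]
    by (auto simp: sets_vimage_algebra2[OF Xsp])
  interpret F: finite_measure_subalgebra M ?F
    by standard (rule sub)
  define \<pi> where "\<pi> v = prob (V -` {v} \<inter> space M)" for v
  have ind_eq: "indicator (V -` {v} \<inter> space M) \<omega> = (indicator {v} (V \<omega>) :: real)"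
    if "\<omega> \<in> space M" for v \<omega> using that by (auto simp: indicator_def)
  have meas_ind [measurable]: "(\<lambda>\<omega>. indicator {v} (V \<omega>) :: real) \<in> borel_measurable M" for v
    by (rule measurable_compose[OF V]) simp
  have exp_ind: "expectation (\<lambda>\<omega>. indicator {v} (V \<omega>) :: real) = \<pi> v" for v
  proof -
    have "expectation (\<lambda>\<omega>. indicator {v} (V \<omega>) :: real) = expectation (indicator (V -` {v} \<inter> space M))"
      by (intro Bochner_Integration.integral_cong refl) (simp add: ind_eq)
    then show ?thesis by (simp add: \<pi>_def Int_assoc)
  qed
  \<comment> \<open>As \<open>V\<close> has finitely many values, functions of it are finite sums of
    indicators. Independence is then needed only for a function of \<open>X\<close> times an
    indicator of \<open>V\<close>.\<close>
  have split: "h (V \<omega>) = (\<Sum>v\<in>C. h v * indicator {v} (V \<omega>))" if "\<omega> \<in> space M" for h :: "'c \<Rightarrow> real" and \<omega>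
    using Vsp[OF that] \<open>finite C\<close> by (simp add: indicator_def sum.delta' if_distrib cong: if_cong)
  have int_ind: "integrable M (\<lambda>\<omega>. indicator {v} (V \<omega>) :: real)" for v
    by (intro integrable_const_bound[where B = 1]) auto
  have mean: "expectation (\<lambda>\<omega>'. h (V \<omega>')) = (\<Sum>v\<in>C. h v * \<pi> v)" for h :: "'c \<Rightarrow> real"
  proof -
    have "expectation (\<lambda>\<omega>'. h (V \<omega>')) = expectation (\<lambda>\<omega>'. \<Sum>v\<in>C. h v * indicator {v} (V \<omega>'))"
      by (intro Bochner_Integration.integral_cong refl) (simp add: split)
    also have "\<dots> = (\<Sum>v\<in>C. h v * \<pi> v)"
      using int_ind by (subst Bochner_Integration.integral_sum) (auto simp: exp_ind)
    finally show ?thesis .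
  qed
  have prod: "integrable M (\<lambda>\<omega>. h (X \<omega>) * indicator {v} (V \<omega>))"
    "expectation (\<lambda>\<omega>. h (X \<omega>) * indicator {v} (V \<omega>)) = expectation (\<lambda>\<omega>. h (X \<omega>)) * \<pi> v"
    if h: "h \<in> borel_measurable N" "integrable M (\<lambda>\<omega>. h (X \<omega>))" for h :: "'b \<Rightarrow> real" and v
  proof -
    have "indep_var borel (h \<circ> g \<circ> U) borel ((indicator {v} :: 'c \<Rightarrow> real) \<circ> V)"
      using indep measurable_comp[OF g h(1)] by (rule indep_var_compose) simp
    then have ind: "indep_var borel (\<lambda>\<omega>. h (X \<omega>)) borel (\<lambda>\<omega>. indicator {v} (V \<omega>) :: real)"
      by (simp add: comp_def X_def)
    show "integrable M (\<lambda>\<omega>. h (X \<omega>) * indicator {v} (V \<omega>))"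
      using indep_var_integrable[OF ind h(2) int_ind] .
    show "expectation (\<lambda>\<omega>. h (X \<omega>) * indicator {v} (V \<omega>)) = expectation (\<lambda>\<omega>. h (X \<omega>)) * \<pi> v"
      using indep_var_lebesgue_integral[OF ind h(2) int_ind] by (simp add: exp_ind)
  qed
  \<comment> \<open>The candidate averages \<open>f\<close> over the law of \<open>V\<close> with
    \<open>X\<close> held fixed. It is tested on the events of \<open>?F\<close>, which are exactly
    the preimages of measurable sets under \<open>X\<close>.\<close>
  have "AE \<omega> in M. real_cond_exp M ?F (\<lambda>\<omega>. f (X \<omega>) (V \<omega>)) \<omega> = (\<Sum>v\<in>C. f (X \<omega>) v * \<pi> v)"
  proof (rule F.real_cond_exp_charact)
    fix E assume "E \<in> sets ?F"
    then obtain S where S [measurable]: "S \<in> sets N" and E: "E = X -` S \<inter> space M"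
      by (auto simp: sets_vimage_algebra2[OF Xsp])
    \<comment> \<open>The factor \<open>indicator S (X \<omega>)\<close> leaves a function of
      \<open>X\<close>, so the factorisation \<open>prod\<close> also covers integrals over
      \<open>E\<close>.\<close>
    have intS: "integrable M (\<lambda>\<omega>. indicator S (X \<omega>) * f (X \<omega>) v)" if "v \<in> C" for v
      using int[OF that] by (rule Bochner_Integration.integrable_bound) (use that in \<open>auto simp: indicator_def\<close>)
    have measS: "(\<lambda>x. indicator S x * f x v) \<in> borel_measurable N" if "v \<in> C" for v
      using that by measurable
    have "(\<integral>\<omega>\<in>E. f (X \<omega>) (V \<omega>) \<partial>M)
        = expectation (\<lambda>\<omega>. \<Sum>v\<in>C. indicator S (X \<omega>) * f (X \<omega>) v * indicator {v} (V \<omega>))"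
      unfolding set_lebesgue_integral_def
    proof (intro Bochner_Integration.integral_cong refl)
      fix \<omega> assume "\<omega> \<in> space M"
      then show "indicat_real E \<omega> *\<^sub>R f (X \<omega>) (V \<omega>)
          = (\<Sum>v\<in>C. indicator S (X \<omega>) * f (X \<omega>) v * indicator {v} (V \<omega>))"
        using split[of \<omega> "\<lambda>v. indicator S (X \<omega>) * f (X \<omega>) v"] by (simp add: E indicator_def)
    qed
    also have "\<dots> = (\<Sum>v\<in>C. expectation (\<lambda>\<omega>. indicator S (X \<omega>) * f (X \<omega>) v) * \<pi> v)"
      using prod[OF measS intS] by (subst Bochner_Integration.integral_sum) auto
    also have "\<dots> = expectation (\<lambda>\<omega>. \<Sum>v\<in>C. indicator S (X \<omega>) * f (X \<omega>) v * \<pi> v)"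
      using intS by (subst Bochner_Integration.integral_sum) auto
    also have "\<dots> = (\<integral>\<omega>\<in>E. (\<Sum>v\<in>C. f (X \<omega>) v * \<pi> v) \<partial>M)"
      unfolding set_lebesgue_integral_def
      by (intro Bochner_Integration.integral_cong refl) (auto simp: E indicator_def)
    finally show "(\<integral>\<omega>\<in>E. f (X \<omega>) (V \<omega>) \<partial>M) = (\<integral>\<omega>\<in>E. (\<Sum>v\<in>C. f (X \<omega>) v * \<pi> v) \<partial>M)" .
  next
    have "integrable M (\<lambda>\<omega>. \<Sum>v\<in>C. f (X \<omega>) v * indicator {v} (V \<omega>))"
      using prod(1)[OF f int] by (intro Bochner_Integration.integrable_sum) auto
    then show "integrable M (\<lambda>\<omega>. f (X \<omega>) (V \<omega>))"
      by (subst Bochner_Integration.integrable_cong[OF refl split])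
  next
    show "integrable M (\<lambda>\<omega>. \<Sum>v\<in>C. f (X \<omega>) v * \<pi> v)"
      using int by (intro Bochner_Integration.integrable_sum) auto
  next
    have [measurable]: "X \<in> measurable ?F N" by (rule measurable_vimage_algebra1[OF Xsp])
    show "(\<lambda>\<omega>. \<Sum>v\<in>C. f (X \<omega>) v * \<pi> v) \<in> borel_measurable ?F" by measurable
  qed
  then show ?thesis by (simp add: mean)
qed

text \<open>Expanding the square gives \<open>card J\<close> diagonal terms, each with the second
  moment as mean, and off-diagonal terms that factor into \<open>m \<bullet> m\<close> by
  independence. Only the variance of a single draw is left beside the squared bias.\<close>

lemma expectation_norm_step_iid:
  fixes Y :: "'i :: finite \<Rightarrow> real ^ 'n" and D :: "'i pmf" and I :: "'j \<Rightarrow> 'a \<Rightarrow> 'i"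
  assumes "finite J" and indep: "indep_vars (\<lambda>_. count_space UNIV) I J"
    and distr: "\<And>j. j \<in> J \<Longrightarrow> distr M (count_space UNIV) (I j) = measure_pmf D"
  defines "m \<equiv> \<Sum>i\<in>UNIV. pmf D i *\<^sub>R Y i"
  shows "expectation (\<lambda>\<omega>. (norm (z - c *\<^sub>R (\<Sum>j\<in>J. Y (I j \<omega>))))\<^sup>2)
    = (norm (z - (c * real (card J)) *\<^sub>R m))\<^sup>2
      + c\<^sup>2 * real (card J) * ((\<Sum>i\<in>UNIV. pmf D i * (norm (Y i))\<^sup>2) - (norm m)\<^sup>2)"
proof -
  have rv: "random_variable (count_space UNIV) (I j)" if "j \<in> J" for j
    using indep that by (auto simp: indep_vars_def)
  have exp1: "expectation (\<lambda>\<omega>. \<phi> (I j \<omega>)) = (\<Sum>i\<in>UNIV. pmf D i * \<phi> i)"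
    if "j \<in> J" for j and \<phi> :: "'i \<Rightarrow> real"
  proof -
    have "expectation (\<lambda>\<omega>. \<phi> (I j \<omega>)) = (\<integral>i. \<phi> i \<partial>distr M (count_space UNIV) (I j))"
      using rv[OF that] by (subst integral_distr) auto
    also have "\<dots> = (\<Sum>i\<in>UNIV. pmf D i * \<phi> i)"
      unfolding distr[OF that] by (subst integral_measure_pmf[of UNIV]) auto
    finally show ?thesis .
  qed
  have int1: "integrable M (\<lambda>\<omega>. \<phi> (I j \<omega>))" if "j \<in> J" for j and \<phi> :: "'i \<Rightarrow> real"
    using rv[OF that] by (rule integrable_finite_range) simp
  have pair: "integrable M (\<lambda>\<omega>. Y (I j \<omega>) \<bullet> Y (I l \<omega>)) \<and>
      expectation (\<lambda>\<omega>. Y (I j \<omega>) \<bullet> Y (I l \<omega>)) = m \<bullet> m" if "j \<in> J" "l \<in> J" "j \<noteq> l" for j l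
  proof -
    \<comment> \<open>Independence factors products of real variables, so the inner product is
      treated coordinate by coordinate.\<close>
    have *: "integrable M (\<lambda>\<omega>. Y (I j \<omega>) $ s * Y (I l \<omega>) $ s) \<and>
        expectation (\<lambda>\<omega>. Y (I j \<omega>) $ s * Y (I l \<omega>) $ s) = m $ s * m $ s" for s
    proof -
      have "indep_vars (\<lambda>_. borel) (\<lambda>j \<omega>. Y (I j \<omega>) $ s) J"
        using indep by (rule indep_vars_compose2) simp
      then have ind: "indep_vars (\<lambda>_. borel) (\<lambda>j \<omega>. Y (I j \<omega>) $ s) {j, l}"
        by (rule indep_vars_subset) (use that in auto)
      have int': "integrable M (\<lambda>\<omega>. Y (I i \<omega>) $ s)" if "i \<in> {j, l}" for i
        using that \<open>j \<in> J\<close> \<open>l \<in> J\<close> int1[of i "\<lambda>i. Y i $ s"] by auto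
      have m: "(\<Sum>i\<in>UNIV. pmf D i * Y i $ s) = m $ s" by (simp add: m_def)
      show ?thesis
        using indep_vars_integrable[OF _ ind int'] indep_vars_lebesgue_integral[OF _ ind int'] that
          exp1[OF that(1), of "\<lambda>i. Y i $ s"] exp1[OF that(2), of "\<lambda>i. Y i $ s"]
        by (simp add: m)
    qed
    then show ?thesis
      unfolding inner_vec_def by (simp add: Bochner_Integration.integral_sum)
  qed
  define s where "s = (\<Sum>i\<in>UNIV. pmf D i * (norm (Y i))\<^sup>2)"
  have diag: "expectation (\<lambda>\<omega>. Y (I j \<omega>) \<bullet> Y (I j \<omega>)) = s" if "j \<in> J" for j
    using exp1[OF that, of "\<lambda>i. Y i \<bullet> Y i"] by (simp add: s_def power2_norm_eq_inner)
  have lin: "expectation (\<lambda>\<omega>. z \<bullet> Y (I j \<omega>)) = z \<bullet> m" if "j \<in> J" for j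
    using exp1[OF that, of "\<lambda>i. z \<bullet> Y i"] by (simp add: m_def inner_sum_right)
  have int2: "integrable M (\<lambda>\<omega>. Y (I j \<omega>) \<bullet> Y (I l \<omega>))" if "j \<in> J" "l \<in> J" for j l
    using pair[OF that] int1[OF that(1), of "\<lambda>i. Y i \<bullet> Y i"] by (cases "j = l") auto
  have expand: "(norm (z - c *\<^sub>R (\<Sum>j\<in>J. Y (I j \<omega>))))\<^sup>2
      = z \<bullet> z - 2 * c * (\<Sum>j\<in>J. z \<bullet> Y (I j \<omega>)) + c\<^sup>2 * (\<Sum>j\<in>J. \<Sum>l\<in>J. Y (I j \<omega>) \<bullet> Y (I l \<omega>))" for \<omega>
  proof -
    have "(\<Sum>j\<in>J. Y (I j \<omega>)) \<bullet> (\<Sum>j\<in>J. Y (I j \<omega>)) = (\<Sum>j\<in>J. \<Sum>l\<in>J. Y (I j \<omega>) \<bullet> Y (I l \<omega>))"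
      unfolding inner_sum_left inner_sum_right by (rule sum.swap)
    moreover have "z \<bullet> (\<Sum>j\<in>J. Y (I j \<omega>)) = (\<Sum>j\<in>J. z \<bullet> Y (I j \<omega>))"
      by (simp add: inner_sum_right)
    ultimately show ?thesis
      unfolding power2_norm_eq_inner
      by (simp add: inner_diff_left inner_diff_right power2_eq_square inner_commute[of "sum _ _" z]
          right_diff_distrib del: inner_sum_left inner_sum_right)
  qed
  have row: "(\<Sum>l\<in>J. expectation (\<lambda>\<omega>. Y (I j \<omega>) \<bullet> Y (I l \<omega>))) = s + (real (card J) - 1) * (m \<bullet> m)"
    if "j \<in> J" for j
  proof -
    have "(\<Sum>l\<in>J. expectation (\<lambda>\<omega>. Y (I j \<omega>) \<bullet> Y (I l \<omega>)))
        = s + (\<Sum>l\<in>J - {j}. expectation (\<lambda>\<omega>. Y (I j \<omega>) \<bullet> Y (I l \<omega>)))"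
      using that \<open>finite J\<close> by (subst sum.remove[of _ j]) (auto simp: diag)
    also have "(\<Sum>l\<in>J - {j}. expectation (\<lambda>\<omega>. Y (I j \<omega>) \<bullet> Y (I l \<omega>))) = (\<Sum>l\<in>J - {j}. m \<bullet> m)"
      using pair that by (intro sum.cong) auto
    also have "\<dots> = (real (card J) - 1) * (m \<bullet> m)" using that \<open>finite J\<close>
      by (cases "card J") (auto simp: card_Diff_singleton)
    finally show ?thesis .
  qed
  have "expectation (\<lambda>\<omega>. (norm (z - c *\<^sub>R (\<Sum>j\<in>J. Y (I j \<omega>))))\<^sup>2)
      = z \<bullet> z - 2 * c * (\<Sum>j\<in>J. expectation (\<lambda>\<omega>. z \<bullet> Y (I j \<omega>)))
        + c\<^sup>2 * (\<Sum>j\<in>J. \<Sum>l\<in>J. expectation (\<lambda>\<omega>. Y (I j \<omega>) \<bullet> Y (I l \<omega>)))"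
  proof -
    have i1: "integrable M (\<lambda>\<omega>. \<Sum>j\<in>J. z \<bullet> Y (I j \<omega>))"
      using int1[of _ "\<lambda>i. z \<bullet> Y i"] by (intro Bochner_Integration.integrable_sum) simp
    have i2: "integrable M (\<lambda>\<omega>. \<Sum>j\<in>J. \<Sum>l\<in>J. Y (I j \<omega>) \<bullet> Y (I l \<omega>))"
      using int2 by (intro Bochner_Integration.integrable_sum) simp
    have e1: "expectation (\<lambda>\<omega>. \<Sum>j\<in>J. z \<bullet> Y (I j \<omega>)) = (\<Sum>j\<in>J. expectation (\<lambda>\<omega>. z \<bullet> Y (I j \<omega>)))"
      using int1[of _ "\<lambda>i. z \<bullet> Y i"] by (intro Bochner_Integration.integral_sum) simp
    have e2: "expectation (\<lambda>\<omega>. \<Sum>j\<in>J. \<Sum>l\<in>J. Y (I j \<omega>) \<bullet> Y (I l \<omega>))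
        = (\<Sum>j\<in>J. \<Sum>l\<in>J. expectation (\<lambda>\<omega>. Y (I j \<omega>) \<bullet> Y (I l \<omega>)))"
      using int2 by (subst Bochner_Integration.integral_sum; (intro sum.cong refl Bochner_Integration.integral_sum)?)
        (auto intro!: Bochner_Integration.integrable_sum)
    show ?thesis
      unfolding expand e1[symmetric] e2[symmetric] using i1 i2 by (simp add: prob_space)
  qed
  also have "\<dots> = z \<bullet> z - 2 * c * real (card J) * (z \<bullet> m) + c\<^sup>2 * (real (card J) * (s + (real (card J) - 1) * (m \<bullet> m)))"
    by (simp add: lin row)
  \<comment> \<open>With \<open>N = card J\<close>, splitting
    \<open>s + (N - 1) * (m \<bullet> m)\<close> as
    \<open>N * (m \<bullet> m) + (s - m \<bullet> m)\<close> lets the first summand complete the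
    square.\<close>
  also have "\<dots> = (norm (z - (c * real (card J)) *\<^sub>R m))\<^sup>2 + c\<^sup>2 * real (card J) * (s - (norm m)\<^sup>2)"
    unfolding power2_norm_eq_inner
    by (simp add: inner_diff_left inner_diff_right inner_commute[of m z] power2_eq_square algebra_simps)
  finally show ?thesis by (simp add: s_def)
qed

end

section \<open>Moments of a Kaczmarz direction and the contraction matrix\<close>

lemma inner_row:
  fixes A :: "real ^ 'n ^ 'm"
  shows "row i A \<bullet> u = (A *v u) $ i"
  by (simp add: matrix_vector_mul_component row_def vec_lambda_eta)

lemma sum_scaleR_rows:
  fixes A :: "real ^ 'n ^ 'm"
  shows "(\<Sum>i\<in>UNIV. c $ i *\<^sub>R row i A) = transpose A *v c"
  unfolding matrix_mult_sum by (simp add: scalar_mult_eq_scaleR)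

text \<open>Sampling proportionally to the squared row norms cancels the row normalisation in both
  moments, leaving sums over the entries of \<open>A *v z - r\<close>. The normal equation removes
  \<open>r\<close> from the mean and the cross term from the second moment.\<close>

lemma
  fixes A :: "real ^ 'n ^ 'm" and z :: "real ^ 'n" and r :: "real ^ 'm"
  assumes rows: "\<And>i. row i A \<noteq> 0" and normal: "transpose A *v r = 0"
  defines "\<pi> \<equiv> \<lambda>i. (norm (row i A))\<^sup>2 / (frobenius_norm A)\<^sup>2"
    and "Y \<equiv> \<lambda>i. ((row i A \<bullet> z - r $ i) / (norm (row i A))\<^sup>2) *\<^sub>R row i A"
    and "G \<equiv> (1 / (frobenius_norm A)\<^sup>2) *\<^sub>R (transpose A ** A)"
  shows kaczmarz_direction_mean: "(\<Sum>i\<in>UNIV. \<pi> i *\<^sub>R Y i) = G *v z"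
    and kaczmarz_direction_second_moment:
      "(\<Sum>i\<in>UNIV. \<pi> i * (norm (Y i))\<^sup>2) = z \<bullet> (G *v z) + (norm r)\<^sup>2 / (frobenius_norm A)\<^sup>2"
proof -
  define F where "F = (frobenius_norm A)\<^sup>2"
  have Gz: "G *v z = (1 / F) *\<^sub>R (transpose A *v (A *v z))"
    by (simp only: G_def F_def scaleR_matrix_vector_assoc matrix_vector_mul_assoc)
  have "\<pi> i *\<^sub>R Y i = (1 / F) *\<^sub>R ((A *v z - r) $ i *\<^sub>R row i A)" for i
    using rows[of i] by (simp add: \<pi>_def Y_def F_def inner_row)
  then have "(\<Sum>i\<in>UNIV. \<pi> i *\<^sub>R Y i) = (1 / F) *\<^sub>R (transpose A *v (A *v z - r))"
    unfolding sum_scaleR_rows[symmetric] scaleR_sum_right by (intro sum.cong refl)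
  then show "(\<Sum>i\<in>UNIV. \<pi> i *\<^sub>R Y i) = G *v z"
    by (simp only: Gz matrix_vector_mult_diff_distrib normal diff_zero)
  have "\<pi> i * (norm (Y i))\<^sup>2 = (1 / F) * ((A *v z - r) $ i)\<^sup>2" for i
    using rows[of i]
    by (simp add: \<pi>_def Y_def F_def inner_row power_mult_distrib power_divide power2_eq_square)
  then have "(\<Sum>i\<in>UNIV. \<pi> i * (norm (Y i))\<^sup>2) = (1 / F) * (\<Sum>i\<in>UNIV. ((A *v z - r) $ i)\<^sup>2)"
    unfolding sum_distrib_left by (intro sum.cong refl)
  also have "(\<Sum>i\<in>UNIV. ((A *v z - r) $ i)\<^sup>2) = (norm (A *v z - r))\<^sup>2"
    unfolding power2_norm_eq_inner inner_vec_def by (simp add: power2_eq_square)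
  also have "\<dots> = (norm (A *v z))\<^sup>2 + (norm r)\<^sup>2"
  proof -
    have "r \<bullet> (A *v z) = 0"
      by (simp only: inner_transpose_matrix_vector[symmetric] normal inner_zero_left)
    then show ?thesis
      by (simp add: power2_norm_eq_inner inner_diff_left inner_diff_right inner_commute[of "A *v z" r])
  qed
  also have "(norm (A *v z))\<^sup>2 = z \<bullet> (transpose A *v (A *v z))"
    by (simp only: power2_norm_eq_inner inner_commute[of z] inner_transpose_matrix_vector)
  finally show "(\<Sum>i\<in>UNIV. \<pi> i * (norm (Y i))\<^sup>2) = z \<bullet> (G *v z) + (norm r)\<^sup>2 / (frobenius_norm A)\<^sup>2"
    by (simp add: Gz F_def add_divide_distrib)
qed

text \<open>This identifies squared bias plus variance with the form of the matrix in the theorem,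
  for \<beta> equal to \<alpha> squared over \<open>q\<close>. Symmetry gives
  \<open>z \<bullet> (G *v (G *v z)) = (norm (G *v z))\<^sup>2\<close>.\<close>

lemma contraction_quadratic_form:
  fixes G :: "real ^ 'n ^ 'n"
  assumes sym: "transpose G = G"
  shows "z \<bullet> (((mat 1 - \<alpha> *\<^sub>R G) ** (mat 1 - \<alpha> *\<^sub>R G) + \<beta> *\<^sub>R ((mat 1 - G) ** G)) *v z)
    = (norm (z - \<alpha> *\<^sub>R (G *v z)))\<^sup>2 + \<beta> * (z \<bullet> (G *v z) - (norm (G *v z))\<^sup>2)"
proof -
  define y where "y = G *v z"
  have zGy: "z \<bullet> (G *v y) = y \<bullet> y"
    unfolding y_def using inner_transpose_matrix_vector[of G z "G *v z"] sym by simp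
  have Gz: "(mat 1 - \<alpha> *\<^sub>R G) *v z = z - \<alpha> *\<^sub>R y" "(mat 1 - G) *v y = y - G *v y"
    "(mat 1 - \<alpha> *\<^sub>R G) *v (z - \<alpha> *\<^sub>R y) = (z - \<alpha> *\<^sub>R y) - \<alpha> *\<^sub>R (y - \<alpha> *\<^sub>R (G *v y))"
    by (simp_all only: y_def matrix_vector_mult_diff_rdistrib matrix_vector_mul_lid
        matrix_vector_mult_diff_distrib matrix_vector_mult_scaleR scaleR_matrix_vector_assoc[symmetric])
  have "((mat 1 - \<alpha> *\<^sub>R G) ** (mat 1 - \<alpha> *\<^sub>R G) + \<beta> *\<^sub>R ((mat 1 - G) ** G)) *v z
      = (z - \<alpha> *\<^sub>R y) - \<alpha> *\<^sub>R (y - \<alpha> *\<^sub>R (G *v y)) + \<beta> *\<^sub>R (y - G *v y)"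
    by (simp only: matrix_vector_mult_add_rdistrib scaleR_matrix_vector_assoc[symmetric]
        matrix_vector_mul_assoc[symmetric] y_def[symmetric] Gz)
  then show ?thesis
    by (simp add: y_def[symmetric] inner_diff_left inner_diff_right inner_add_right zGy
        power2_norm_eq_inner inner_commute[of y z] right_diff_distrib)
qed

section \<open>The one-step error bound\<close>

text \<open>This is what makes the current error a function of past draws alone.\<close>

lemma kaczmarz_avg_iterate_cong:
  assumes "\<And>l. l < k \<Longrightarrow> \<tau> l = \<tau>' l"
  shows "kaczmarz_avg_iterate A b w q x0 \<tau> k = kaczmarz_avg_iterate A b w q x0 \<tau>' k"
  using assms by (induction k) auto

theorem corollary1:
  fixes A :: "real ^ 'n ^ 'm" and b :: "real ^ 'm" and x0 :: "real ^ 'n"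
    and q :: nat and \<alpha> :: real
    and p w :: "'m \<Rightarrow> real" and D :: "'m pmf"
    and M :: "'a measure" and idx :: "nat \<Rightarrow> nat \<Rightarrow> 'a \<Rightarrow> 'm"
    and \<tau> :: "nat \<Rightarrow> 'a \<Rightarrow> 'm multiset"
    and x e :: "nat \<Rightarrow> 'a \<Rightarrow> real ^ 'n" and xstar :: "real ^ 'n" and rstar :: "real ^ 'm"
    and G :: "real ^ 'n ^ 'n" and k :: nat
  assumes "CARD('m) \<ge> CARD('n)" and "rank A = CARD('n)" and "\<And>i. row i A \<noteq> 0"
    and "q \<ge> 1" and "\<alpha> > 0"
    and "\<And>i. p i = (norm (row i A))\<^sup>2 / (frobenius_norm A)\<^sup>2"
    and "\<And>i. w i = \<alpha>"
    and "\<And>i. pmf D i = p i"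
    and "prob_space M"
    and "prob_space.indep_vars M (\<lambda>_. count_space UNIV) (\<lambda>(k, j). idx k j) (UNIV \<times> {..<q})"
    and "\<And>k j. j < q \<Longrightarrow> distr M (count_space UNIV) (idx k j) = measure_pmf D"
  defines "\<tau> \<equiv> \<lambda>k \<omega>. {# idx k j \<omega>. j \<in># mset_set {..<q} #}"
    and "x \<equiv> \<lambda>k \<omega>. kaczmarz_avg_iterate A b w q x0 (\<lambda>l. \<tau> l \<omega>) k"
    and "xstar \<equiv> least_squares_solution A b"
    and "rstar \<equiv> b - A *v xstar"
    and "e \<equiv> \<lambda>k \<omega>. x k \<omega> - xstar"
    and "G \<equiv> (1 / (frobenius_norm A)\<^sup>2) *\<^sub>R (transpose A ** A)"
  shows "AE \<omega> in M.
    real_cond_exp M (vimage_algebra (space M) (e k) borel) (\<lambda>\<omega>. (norm (e (Suc k) \<omega>))\<^sup>2) \<omega>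
      \<le> sigma_max ((mat 1 - \<alpha> *\<^sub>R G) ** (mat 1 - \<alpha> *\<^sub>R G)
                    + (\<alpha>\<^sup>2 / real q) *\<^sub>R ((mat 1 - G) ** G)) * (norm (e k \<omega>))\<^sup>2
        + \<alpha>\<^sup>2 * (norm rstar)\<^sup>2 / (real q * (frobenius_norm A)\<^sup>2)"
proof -
  note rows = assms(3) and pmf = assms(8)[unfolded assms(6)] and indep = assms(10)
  interpret prob_space M by fact
  define I where "I = (\<lambda>(k, j). idx k j)"
  \<comment> \<open>Draws are indexed by (round, slot): \<open>P\<close> holds the rounds before
    \<open>k\<close> and \<open>Q\<close> round \<open>k\<close> itself. The blocks are disjoint, so
    the restrictions \<open>U\<close> and \<open>V\<close> are independent.\<close>
  define P where "P = {..<k} \<times> {..<q}"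
  define Q where "Q = {k} \<times> {..<q}"
  define U where "U \<omega> = restrict (\<lambda>i. I i \<omega>) P" for \<omega>
  define V where "V \<omega> = restrict (\<lambda>i. I i \<omega>) Q" for \<omega>
  define CP where "CP = (P \<rightarrow>\<^sub>E (UNIV :: 'm set))"
  define CQ where "CQ = (Q \<rightarrow>\<^sub>E (UNIV :: 'm set))"
  define g where "g u = kaczmarz_avg_iterate A b w q x0
      (\<lambda>l. {# u (l, j). j \<in># mset_set {..<q} #}) k - xstar" for u
  define Y where "Y z i = ((row i A \<bullet> z - rstar $ i) / (norm (row i A))\<^sup>2) *\<^sub>R row i A" for z i
  define f where "f z v = (norm (z - (\<alpha> / real q) *\<^sub>R (\<Sum>i\<in>Q. Y z (v i))))\<^sup>2" for z v
  define B where "B = (mat 1 - \<alpha> *\<^sub>R G) ** (mat 1 - \<alpha> *\<^sub>R G) + (\<alpha>\<^sup>2 / real q) *\<^sub>R ((mat 1 - G) ** G)"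
  have fin: "finite P" "finite Q" "finite CP" "finite CQ"
    by (auto simp: P_def Q_def CP_def CQ_def intro: finite_PiE)
  have "q > 0" using \<open>q \<ge> 1\<close> by simp
  \<comment> \<open>Finitely many draws from a finite index set make the product sigma-algebras
    discrete, so any function of the past, such as \<open>g\<close>, is measurable.\<close>
  have PiM: "PiM P (\<lambda>_. count_space UNIV) = count_space CP"
    "PiM Q (\<lambda>_. count_space UNIV) = count_space CQ"
    using fin by (simp_all add: CP_def CQ_def count_space_PiM_finite)
  have indep': "indep_vars (\<lambda>_. count_space UNIV) I (UNIV \<times> {..<q})"
    using indep by (simp add: I_def)
  have "indep_var (PiM P (\<lambda>_. count_space UNIV)) U (PiM Q (\<lambda>_. count_space UNIV)) V"
    unfolding U_def[abs_def] V_def[abs_def] using indep'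
    by (rule indep_var_restrict) (auto simp: P_def Q_def)
  then have UV: "indep_var (count_space CP) U (count_space CQ) V"
    by (simp add: PiM)
  have ek: "e k = (\<lambda>\<omega>. g (U \<omega>))"
  proof
    fix \<omega>
    have "kaczmarz_avg_iterate A b w q x0 (\<lambda>l. \<tau> l \<omega>) k
      = kaczmarz_avg_iterate A b w q x0 (\<lambda>l. {# U \<omega> (l, j). j \<in># mset_set {..<q} #}) k"
      by (rule kaczmarz_avg_iterate_cong) (auto simp: \<tau>_def U_def P_def I_def intro!: image_mset_cong)
    then show "e k \<omega> = g (U \<omega>)" by (simp add: e_def x_def g_def)
  qed
  have eSuc: "(norm (e (Suc k) \<omega>))\<^sup>2 = f (e k \<omega>) (V \<omega>)" for \<omega>
  proof -
    \<comment> \<open>Substituting \<open>b = A *v xstar + rstar\<close> expresses the row residual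
      through the error, which is the form used in \<open>Y\<close>.\<close>
    have res: "row i A \<bullet> x k \<omega> - b $ i = row i A \<bullet> e k \<omega> - rstar $ i" for i
      by (simp add: e_def rstar_def inner_diff_right inner_row matrix_vector_mult_diff_distrib)
    have "(\<Sum>i\<in>#\<tau> k \<omega>. (w i * ((row i A \<bullet> x k \<omega> - b $ i) / (norm (row i A))\<^sup>2)) *\<^sub>R row i A)
        = (\<Sum>j<q. \<alpha> *\<^sub>R Y (e k \<omega>) (idx k j \<omega>))"
      by (simp add: \<tau>_def image_mset.compositionality comp_def sum_unfold_sum_mset assms(7) Y_def res)
    also have "\<dots> = \<alpha> *\<^sub>R (\<Sum>i\<in>Q. Y (e k \<omega>) (V \<omega> i))"
    proof -
      have "(\<Sum>i\<in>Q. Y (e k \<omega>) (V \<omega> i)) = (\<Sum>i\<in>Q. case i of (l, j) \<Rightarrow> Y (e k \<omega>) (idx l j \<omega>))"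
        by (intro sum.cong refl) (auto simp: V_def I_def)
      also have "\<dots> = (\<Sum>j<q. Y (e k \<omega>) (idx k j \<omega>))"
        unfolding Q_def sum.cartesian_product[symmetric] by simp
      finally show ?thesis by (simp add: scaleR_sum_right)
    qed
    finally have "e (Suc k) \<omega> = e k \<omega> - (\<alpha> / real q) *\<^sub>R (\<Sum>i\<in>Q. Y (e k \<omega>) (V \<omega> i))"
      unfolding e_def x_def kaczmarz_avg_iterate.simps kaczmarz_avg_step_def by simp
    then show ?thesis by (simp add: f_def)
  qed
  have "transpose A *v rstar = 0"
    unfolding rstar_def xstar_def by (rule least_squares_normal_equation)
  note moments = kaczmarz_direction_mean[OF rows this, folded G_def]
    kaczmarz_direction_second_moment[OF rows this, folded G_def]
  have symG: "transpose G = G"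
    by (simp add: G_def transpose_scalar matrix_transpose_mul)
  \<comment> \<open>For a frozen error \<open>z\<close>, the step factor \<alpha> / \<open>q\<close>
    with \<open>card Q = q\<close> gives the bias coefficient \<alpha> and the variance coefficient
    \<alpha> squared over \<open>q\<close>.\<close>
  have mean: "expectation (\<lambda>\<omega>'. f z (V \<omega>'))
      = z \<bullet> (B *v z) + \<alpha>\<^sup>2 * (norm rstar)\<^sup>2 / (real q * (frobenius_norm A)\<^sup>2)" for z
  proof -
    have "indep_vars (\<lambda>_. count_space UNIV) I Q"
      using indep' by (rule indep_vars_subset) (auto simp: Q_def)
    moreover have "distr M (count_space UNIV) (I i) = measure_pmf D" if "i \<in> Q" for i
      using that assms(11) by (auto simp: Q_def I_def)
    ultimately have "expectation (\<lambda>\<omega>. (norm (z - (\<alpha> / real q) *\<^sub>R (\<Sum>i\<in>Q. Y z (I i \<omega>))))\<^sup>2)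
      = (norm (z - (\<alpha> / real q * real (card Q)) *\<^sub>R (\<Sum>i\<in>UNIV. pmf D i *\<^sub>R Y z i)))\<^sup>2
        + (\<alpha> / real q)\<^sup>2 * real (card Q) * ((\<Sum>i\<in>UNIV. pmf D i * (norm (Y z i))\<^sup>2)
          - (norm (\<Sum>i\<in>UNIV. pmf D i *\<^sub>R Y z i))\<^sup>2)"
      by (rule expectation_norm_step_iid[OF fin(2)])
    moreover have "(\<Sum>i\<in>UNIV. pmf D i *\<^sub>R Y z i) = G *v z"
      and "(\<Sum>i\<in>UNIV. pmf D i * (norm (Y z i))\<^sup>2)
        = z \<bullet> (G *v z) + (norm rstar)\<^sup>2 / (frobenius_norm A)\<^sup>2"
      unfolding Y_def pmf by (rule moments)+
    moreover have "card Q = q" by (simp add: Q_def)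
    moreover have "f z (V \<omega>) = (norm (z - (\<alpha> / real q) *\<^sub>R (\<Sum>i\<in>Q. Y z (I i \<omega>))))\<^sup>2" for \<omega>
      by (simp add: f_def V_def)
    ultimately have "expectation (\<lambda>\<omega>'. f z (V \<omega>')) = (norm (z - \<alpha> *\<^sub>R (G *v z)))\<^sup>2
        + (\<alpha>\<^sup>2 / real q) * (z \<bullet> (G *v z) + (norm rstar)\<^sup>2 / (frobenius_norm A)\<^sup>2 - (norm (G *v z))\<^sup>2)"
      using \<open>q > 0\<close> by (simp add: power_divide power2_eq_square)
    then show ?thesis
      unfolding B_def contraction_quadratic_form[OF symG] by (simp add: algebra_simps)
  qed
  \<comment> \<open>The past enters only through \<open>g (U \<omega>)\<close> and the new draws
    only through \<open>V\<close>, so the freezing lemma reduces the claim to \<open>mean\<close> at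
    \<open>z = e k \<omega>\<close>.\<close>
  have "AE \<omega> in M. real_cond_exp M (vimage_algebra (space M) (e k) borel)
      (\<lambda>\<omega>. f (e k \<omega>) (V \<omega>)) \<omega> = expectation (\<lambda>\<omega>'. f (e k \<omega>) (V \<omega>'))"
    unfolding ek
  proof (rule real_cond_exp_freeze[OF UV fin(4)])
    show "g \<in> borel_measurable (count_space CP)" by simp
    show "(\<lambda>z. f z v) \<in> borel_measurable borel" for v
      unfolding f_def Y_def by measurable
    show "integrable M (\<lambda>\<omega>. f (g (U \<omega>)) v)" for v
      using integrable_finite_range[OF indep_var_rv1[OF UV] fin(3), of "\<lambda>u. f (g u) v"] .
  qed
  then show ?thesis
    unfolding eSuc mean B_def[symmetric]
    by eventually_elim (simp add: quadratic_form_le_sigma_max)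
qed

end
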